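(* Let $q$ be a power of $2$, let $n,t,h,\ell$ be positive integers, let $\mathcal{G}=\mathcal{G}_{(t,h,\ell)}$ be the graph of $(t,h,\ell)$-sets in $\mathbb{F}_q^n$, and let $\mathcal{G}^2$ be its square. Suppose $\mathcal{C}\subseteq\mathbb{F}_q^n$ is a $q$-ary code of length $n$ with minimum Hamming distance $\ell+1$. Then $$\sum_{j=1}^{t}\binom{|\mathcal{C}|}{j}\left(\sum_{k=0}^{h-1}\binom{r_1}{k}\right)^{j}\;\le\;\chi(\mathcal{G}^2)\;\le\;\sum_{j=0}^{2t}\binom{q^n}{j}\left(\sum_{k=0}^{h-1}\binom{r_2}{k}\right)^{j},$$ where $\chi$ denotes the chromatic number and $$r_1=\sum_{i=1}^{\lfloor \ell/2\rfloor}\binom{n}{i}(q-1)^i,\qquad r_2=\sum_{i=1}^{\ell}\binom{n}{i}(q-1)^i.$$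
   Context: For $\mathbf{x},\mathbf{y}\in\mathbb{F}_q^n$, $d_H(\mathbf{x},\mathbf{y})$ is the Hamming distance. For $S^A,S^B\subseteq\mathbb{F}_q^n$, the pair $(S^A,S^B)$ are called $(t,h,\ell)$-sets if the symmetric difference can be written as $S^A\bigtriangleup S^B=\bigcup_{i=1}^{j}\{\mathbf{x}_{i,1},\dots,\mathbf{x}_{i,k_i}\}$ with $j\le t$, $k_i\le h$ for all $1\le i\le j$, and $d_H(\mathbf{u},\mathbf{w})\le\ell$ for any $\mathbf{u},\mathbf{w}$ in the same set $\{\mathbf{x}_{i,1},\dots,\mathbf{x}_{i,k_i}\}$. The undirected graph $\mathcal{G}_{(t,h,\ell)}$ has as vertices all $2^{q^n}$ subsets of $\mathbb{F}_q^n$; two distinct vertices are joined by an edge if and only if they are $(t,h,\ell)$-sets. The square $\mathcal{G}^2$ of a graph $\mathcal{G}$ has the same vertex set, with two vertices adjacent if and only if their distance in $\mathcal{G}$ is $1$ or $2$. *)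

theory Defs
  imports "HOL-Analysis.Finite_Cartesian_Product" "HOL-Library.Extended_Nat"
begin

definition hamming_dist :: "'a ^ 'n \<Rightarrow> 'a ^ 'n \<Rightarrow> nat" where
  "hamming_dist x y = card {i. x $ i \<noteq> y $ i}"

text \<open>
  A minimum distance is attained by a pair of distinct codewords,
  so a code having one contains at least two codewords.
\<close>

definition has_min_distance :: "('a ^ 'n) set \<Rightarrow> nat \<Rightarrow> bool" where
  "has_min_distance C d \<longleftrightarrow>
     (\<exists>x\<in>C. \<exists>y\<in>C. x \<noteq> y \<and> hamming_dist x y = d) \<and>
     (\<forall>x\<in>C. \<forall>y\<in>C. x \<noteq> y \<longrightarrow> d \<le> hamming_dist x y)"

text \<open>
  The cluster \<open>X i\<close> is the set listed as $x_{i,1}, \dots, x_{i,k_i}$ with $k_i \le h$.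
  Clusters may overlap or be empty, and \<open>j = 0\<close> is allowed; this does not
  affect which pairs of sets satisfy the condition, apart from \<open>SA = SB\<close>, which is never an edge.
\<close>

definition thl_sets ::
    "nat \<Rightarrow> nat \<Rightarrow> nat \<Rightarrow> ('a::finite ^ 'n) set \<Rightarrow> ('a ^ 'n) set \<Rightarrow> bool" where
  "thl_sets t h l SA SB \<longleftrightarrow>
     (\<exists>j (X :: nat \<Rightarrow> ('a ^ 'n) set).
        j \<le> t \<and> sym_diff SA SB = (\<Union>i\<in>{1..j}. X i) \<and>
        (\<forall>i\<in>{1..j}. card (X i) \<le> h \<and> (\<forall>u\<in>X i. \<forall>w\<in>X i. hamming_dist u w \<le> l)))"

text \<open>
  A graph is given by its adjacency relation; its vertices are all elements of the type.
  For \<open>thl_graph\<close> these are all subsets of the space \<open>'a ^ 'n\<close>.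
\<close>

definition thl_graph ::
    "nat \<Rightarrow> nat \<Rightarrow> nat \<Rightarrow> ('a::finite ^ 'n) set \<Rightarrow> ('a ^ 'n) set \<Rightarrow> bool" where
  "thl_graph t h l SA SB \<longleftrightarrow> SA \<noteq> SB \<and> thl_sets t h l SA SB"

text \<open>
  \<open>(E ^^ k) u v\<close> says that there is a walk with \<open>k\<close> edges from \<open>u\<close> to \<open>v\<close>.
  The distance is \<open>\<infinity>\<close> if there is no walk at all.
\<close>

definition graph_dist :: "('v \<Rightarrow> 'v \<Rightarrow> bool) \<Rightarrow> 'v \<Rightarrow> 'v \<Rightarrow> enat" where
  "graph_dist E u v = (INF k\<in>{k. (E ^^ k) u v}. enat k)"

definition graph_square :: "('v \<Rightarrow> 'v \<Rightarrow> bool) \<Rightarrow> 'v \<Rightarrow> 'v \<Rightarrow> bool" where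
  "graph_square E u v \<longleftrightarrow> graph_dist E u v = 1 \<or> graph_dist E u v = 2"

definition proper_coloring :: "('v \<Rightarrow> 'v \<Rightarrow> bool) \<Rightarrow> nat \<Rightarrow> ('v \<Rightarrow> nat) \<Rightarrow> bool" where
  "proper_coloring E k c \<longleftrightarrow> (\<forall>v. c v < k) \<and> (\<forall>u v. E u v \<longrightarrow> c u \<noteq> c v)"

text \<open>Meaningful for loopless graphs on a finite type, where some proper coloring exists.\<close>

definition chromatic_number :: "('v::finite \<Rightarrow> 'v \<Rightarrow> bool) \<Rightarrow> nat" where
  "chromatic_number E = (LEAST k. \<exists>c. proper_coloring E k c)"

end

theory Submission
  imports Defs
begin

text \<open>
  Lower bound: any two neighbours of the vertex \<open>{}\<close> are at distance at most 2, so the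
  neighbours of \<open>{}\<close> form a clique of the square. Attach to each codeword of a
  nonempty set of at most \<open>t\<close> codewords at most \<open>h - 1\<close> further points of its ball of radius
  \<open>\<lfloor>l/2\<rfloor>\<close>; these balls are disjoint, so the resulting sets are distinct.

  Upper bound: colour greedily. If \<open>B\<close> is in the closed neighbourhood of \<open>A\<close> in the square, then
  the symmetric difference of \<open>A\<close> and \<open>B\<close> is a union of at most \<open>2 t\<close> clusters. After making
  the clusters disjoint and nonempty, a point chosen in each of them gives distinct centres, and
  the remaining points of a cluster lie in the punctured ball of radius \<open>l\<close> around its centre.
\<close>

section \<open>Greedy colourings and cliques\<close>

text \<open>Induction on the set of vertices coloured so far. A new vertex belongs to its own closed
  neighbourhood, so it has fewer than \<open>m\<close> neighbours and some colour below
  \<open>m\<close> is free.\<close>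

lemma greedy_coloring:
  fixes E :: "'v::finite \<Rightarrow> 'v \<Rightarrow> bool"
  assumes sym: "\<And>u v. E u v \<Longrightarrow> E v u" and irrefl: "\<And>v. \<not> E v v"
    and deg: "\<And>v. card {w. w = v \<or> E v w} \<le> m"
  shows "\<exists>c. proper_coloring E m c"
proof -
  have "\<exists>c. \<forall>v\<in>S. c v < m \<and> (\<forall>u\<in>S. E u v \<longrightarrow> c u \<noteq> c v)" for S :: "'v set"
    using finite[of S]
  proof (induction S rule: finite_induct)
    case empty
    then show ?case by simp
  next
    case (insert x S)
    then obtain c :: "'v \<Rightarrow> nat"
      where c: "\<And>v. v \<in> S \<Longrightarrow> c v < m" "\<And>u v. u \<in> S \<Longrightarrow> v \<in> S \<Longrightarrow> E u v \<Longrightarrow> c u \<noteq> c v"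
      by blast
    have "{w. w = x \<or> E x w} = insert x {w. E x w}"
      by auto
    then have "card {w. E x w} < m"
      using deg[of x] irrefl[of x] by simp
    then have "card (c ` {w. E x w}) < card {..<m}"
      using card_image_le[of "{w. E x w}" c] by simp
    then obtain a where a: "a < m" "a \<notin> c ` {w. E x w}"
      by (metis card_mono finite finite_imageI lessThan_iff not_less subsetI)
    show ?case
      using insert.hyps c a irrefl by (intro exI[of _ "c(x := a)"]) (auto dest: sym)
  qed
  from this[of UNIV] show ?thesis
    by (auto simp: proper_coloring_def)
qed

lemma chromatic_number_le:
  assumes "proper_coloring E m c"
  shows "chromatic_number E \<le> m"
  unfolding chromatic_number_def using assms by (auto intro: Least_le)

lemma clique_le_chromatic_number:
  fixes E :: "'v::finite \<Rightarrow> 'v \<Rightarrow> bool"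
  assumes sym: "\<And>u v. E u v \<Longrightarrow> E v u" and irrefl: "\<And>v. \<not> E v v"
    and clique: "\<And>u v. u \<in> K \<Longrightarrow> v \<in> K \<Longrightarrow> u \<noteq> v \<Longrightarrow> E u v"
  shows "card K \<le> chromatic_number E"
proof -
  \<comment> \<open>Some colouring must exist before \<open>LEAST\<close> can be known to be
    attained; closed neighbourhoods never exceed the whole type.\<close>
  have "\<exists>c. proper_coloring E CARD('v) c"
    by (rule greedy_coloring) (auto simp: irrefl card_mono intro: sym)
  then have "\<exists>c. proper_coloring E (chromatic_number E) c"
    unfolding chromatic_number_def by (rule LeastI)
  then obtain c where c: "proper_coloring E (chromatic_number E) c" ..
  then have "inj_on c K"
    using clique unfolding inj_on_def proper_coloring_def by metis
  moreover have "c ` K \<subseteq> {..<chromatic_number E}"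
    using c by (auto simp: proper_coloring_def)
  ultimately show ?thesis
    by (metis card_image card_lessThan card_mono finite_lessThan)
qed

section \<open>Distance and the square of a graph\<close>

text \<open>A nonempty set of lengths attains its infimum in \<open>enat\<close>, while the infimum
  of the empty set is infinite.\<close>

lemma graph_dist_le_iff: "graph_dist E u v \<le> enat k \<longleftrightarrow> (\<exists>i\<le>k. (E ^^ i) u v)"
proof
  assume le: "graph_dist E u v \<le> enat k"
  show "\<exists>i\<le>k. (E ^^ i) u v"
  proof (cases "{k. (E ^^ k) u v} = {}")
    case True
    then show ?thesis using le by (simp add: graph_dist_def top_enat_def)
  next
    case False
    then have "Inf (enat ` {k. (E ^^ k) u v}) \<in> enat ` {k. (E ^^ k) u v}"
      by (metis Inf_enat_def LeastI equals0I image_is_empty)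
    then show ?thesis using le by (auto simp: graph_dist_def)
  qed
next
  assume "\<exists>i\<le>k. (E ^^ i) u v"
  then obtain i where "i \<le> k" "(E ^^ i) u v" by blast
  then show "graph_dist E u v \<le> enat k"
    unfolding graph_dist_def by (intro INF_lower2[of i]) auto
qed

lemma graph_square_iff:
  "graph_square E u v \<longleftrightarrow> u \<noteq> v \<and> (E u v \<or> (\<exists>w. E u w \<and> E w v))"
proof -
  \<comment> \<open>Distance 1 or 2 means at most 2 but not 0. Excluding 0 matters: going along an
    edge and back is a walk of length 2 from \<open>u\<close> to itself.\<close>
  have "graph_square E u v \<longleftrightarrow> graph_dist E u v \<le> enat 2 \<and> \<not> graph_dist E u v \<le> enat 0"
    unfolding graph_square_def
    by (cases "graph_dist E u v") (auto simp: one_enat_def numeral_eq_enat)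
  moreover have "(\<exists>i\<le>2. (E ^^ i) u v) \<longleftrightarrow> u = v \<or> E u v \<or> (\<exists>w. E u w \<and> E w v)"
    by (simp add: numeral_2_eq_2 le_Suc_eq ex_disj_distrib conj_disj_distribR) blast
  ultimately show ?thesis
    unfolding graph_dist_le_iff by auto
qed

lemma graph_square_sym:
  assumes "\<And>u v. E u v \<Longrightarrow> E v u" "graph_square E u v"
  shows "graph_square E v u"
  using assms unfolding graph_square_iff by blast

section \<open>Hamming distance and sizes of balls\<close>

lemma hamming_dist_commute: "hamming_dist x y = hamming_dist y x"
  unfolding hamming_dist_def by (rule arg_cong[where f = card]) auto

lemma hamming_dist_self [simp]: "hamming_dist x x = 0"
  by (simp add: hamming_dist_def)

lemma hamming_dist_eq_0_iff: "hamming_dist x (y :: 'a ^ 'n::finite) = 0 \<longleftrightarrow> x = y"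
  by (auto simp: hamming_dist_def vec_eq_iff)

lemma hamming_dist_triangle:
  "hamming_dist x (z :: 'a ^ 'n::finite) \<le> hamming_dist x y + hamming_dist y z"
proof -
  have "card {i. x $ i \<noteq> z $ i} \<le> card ({i. x $ i \<noteq> y $ i} \<union> {i. y $ i \<noteq> z $ i})"
    by (rule card_mono) auto
  also have "\<dots> \<le> card {i. x $ i \<noteq> y $ i} + card {i. y $ i \<noteq> z $ i}"
    by (rule card_Un_le)
  finally show ?thesis by (simp add: hamming_dist_def)
qed

text \<open>Such a \<open>y\<close> is determined by its restriction to \<open>S\<close>, where each
  coordinate may be anything except that of \<open>x\<close>.\<close>

lemma card_vec_differing_on:
  fixes x :: "'a::finite ^ 'n::finite"
  shows "card {y. {i. x $ i \<noteq> y $ i} = S} = (CARD('a) - 1) ^ card S"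
proof -
  have "bij_betw (\<lambda>y. restrict (vec_nth y) S) {y. {i. x $ i \<noteq> y $ i} = S}
      (PiE S (\<lambda>i. UNIV - {x $ i}))"
  proof (rule bij_betw_byWitness[where f' = "\<lambda>f. \<chi> i. if i \<in> S then f i else x $ i"])
    show "(\<lambda>f. \<chi> i. if i \<in> S then f i else x $ i) ` PiE S (\<lambda>i. UNIV - {x $ i})
        \<subseteq> {y. {i. x $ i \<noteq> y $ i} = S}"
      by (fastforce simp: PiE_iff split: if_splits)
  qed (auto simp: vec_eq_iff fun_eq_iff PiE_iff extensional_def restrict_def)
  then have "card {y. {i. x $ i \<noteq> y $ i} = S} = card (PiE S (\<lambda>i. UNIV - {x $ i}))"
    by (rule bij_betw_same_card)
  then show ?thesis
    by (simp add: card_PiE card_Diff_singleton)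
qed

lemma card_hamming_sphere:
  fixes x :: "'a::finite ^ 'n::finite"
  shows "card {y. hamming_dist x y = i} = (CARD('n) choose i) * (CARD('a) - 1) ^ i"
proof -
  have "{y. hamming_dist x y = i} =
      (\<Union>S\<in>{S. S \<subseteq> UNIV \<and> card S = i}. {y. {i. x $ i \<noteq> y $ i} = S})"
    by (auto simp: hamming_dist_def)
  also have "card \<dots> = (\<Sum>S\<in>{S. S \<subseteq> (UNIV :: 'n set) \<and> card S = i}. (CARD('a) - 1) ^ card S)"
    by (subst card_UN_disjoint) (auto simp: card_vec_differing_on)
  also have "\<dots> = (CARD('n) choose i) * (CARD('a) - 1) ^ i"
    using n_subsets[of "UNIV :: 'n set" i] by simp
  finally show ?thesis .
qed

text \<open>The centre is left out because it is already a point of the cluster; this is why the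
  sums in \<open>r1\<close> and \<open>r2\<close> start at \<open>i = 1\<close> and at most
  \<open>h - 1\<close> points are chosen.\<close>

definition punctured_ball :: "nat \<Rightarrow> 'a ^ 'n \<Rightarrow> ('a ^ 'n) set" where
  "punctured_ball r x = {y. y \<noteq> x \<and> hamming_dist x y \<le> r}"

lemma card_punctured_ball:
  fixes x :: "'a::finite ^ 'n::finite"
  shows "card (punctured_ball r x) = (\<Sum>i = 1..r. (CARD('n) choose i) * (CARD('a) - 1) ^ i)"
proof -
  have "punctured_ball r x = (\<Union>i\<in>{1..r}. {y. hamming_dist x y = i})"
    by (auto simp: punctured_ball_def Suc_le_eq hamming_dist_eq_0_iff neq0_conv[symmetric]
        simp del: neq0_conv)
  also have "card \<dots> = (\<Sum>i = 1..r. card {y. hamming_dist x y = i})"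
    by (rule card_UN_disjoint) auto
  finally show ?thesis
    by (simp add: card_hamming_sphere)
qed

section \<open>Counting systems of centres and attached points\<close>

lemma card_subsets_card_le:
  assumes "finite B"
  shows "card {K. K \<subseteq> B \<and> card K \<le> m} = (\<Sum>k = 0..m. card B choose k)"
proof -
  have "{K. K \<subseteq> B \<and> card K \<le> m} = (\<Union>k\<in>{0..m}. {K. K \<subseteq> B \<and> card K = k})"
    by auto
  also have "card \<dots> = (\<Sum>k = 0..m. card {K. K \<subseteq> B \<and> card K = k})"
    using assms by (intro card_UN_disjoint) auto
  finally show ?thesis
    using assms by (simp add: n_subsets)
qed

lemma card_Sigma_subsets_PiE:
  assumes "finite V" "finite J" "\<And>x. x \<in> V \<Longrightarrow> finite (F x) \<and> card (F x) = M"
  shows "card (SIGMA T:{T. T \<subseteq> V \<and> card T \<in> J}. PiE T F) = (\<Sum>j\<in>J. (card V choose j) * M ^ j)"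
proof -
  have "card (SIGMA T:{T. T \<subseteq> V \<and> card T \<in> J}. PiE T F)
      = (\<Sum>T\<in>{T. T \<subseteq> V \<and> card T \<in> J}. card (PiE T F))"
    using assms by (intro card_SigmaI) (auto intro!: finite_PiE intro: finite_subset)
  also have "\<dots> = (\<Sum>T\<in>{T. T \<subseteq> V \<and> card T \<in> J}. M ^ card T)"
  proof (rule sum.cong)
    fix T assume "T \<in> {T. T \<subseteq> V \<and> card T \<in> J}"
    then have "finite T" "\<And>x. x \<in> T \<Longrightarrow> card (F x) = M"
      using assms finite_subset by auto
    then show "card (PiE T F) = M ^ card T"
      by (simp add: card_PiE)
  qed simp
  also have "\<dots> = (\<Sum>T\<in>(\<Union>j\<in>J. {T. T \<subseteq> V \<and> card T = j}). M ^ card T)"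
    by (rule sum.cong) auto
  also have "\<dots> = (\<Sum>j\<in>J. \<Sum>T\<in>{T. T \<subseteq> V \<and> card T = j}. M ^ card T)"
    using assms by (intro sum.UNION_disjoint) auto
  finally show ?thesis
    using assms by (simp add: n_subsets)
qed

text \<open>
  A pair \<open>(T, f)\<close> encodes the clusters \<open>insert x (f x)\<close> with centres \<open>x \<in> T\<close>.
\<close>

definition star_systems ::
    "('a ^ 'n) set \<Rightarrow> nat set \<Rightarrow> nat \<Rightarrow> nat \<Rightarrow>
      (('a ^ 'n) set \<times> ('a ^ 'n \<Rightarrow> ('a ^ 'n) set)) set" where
  "star_systems V J m r =
     (SIGMA T:{T. T \<subseteq> V \<and> card T \<in> J}. PiE T (\<lambda>x. {K. K \<subseteq> punctured_ball r x \<and> card K \<le> m}))"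

definition star_union :: "'b set \<times> ('b \<Rightarrow> 'b set) \<Rightarrow> 'b set" where
  "star_union p = (\<Union>x\<in>fst p. insert x (snd p x))"

text \<open>Gives both bounds of the theorem: the lower one with \<open>V = C\<close>,
  \<open>J = {1..t}\<close> and radius \<open>l div 2\<close>, the upper one with
  \<open>V = UNIV\<close>, \<open>J = {0..2 * t}\<close> and radius \<open>l\<close>.\<close>

lemma card_star_systems:
  fixes V :: "('a::finite ^ 'n::finite) set"
  assumes "finite J"
  shows "card (star_systems V J m r) = (\<Sum>j\<in>J. (card V choose j) *
    (\<Sum>k = 0..m. (\<Sum>i = 1..r. (CARD('n) choose i) * (CARD('a) - 1) ^ i) choose k) ^ j)"
  unfolding star_systems_def using assms
  by (intro card_Sigma_subsets_PiE) (auto simp: card_subsets_card_le card_punctured_ball)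

section \<open>Clusters and the relation \<open>thl_sets\<close>\<close>

definition cluster :: "nat \<Rightarrow> nat \<Rightarrow> ('a ^ 'n) set \<Rightarrow> bool" where
  "cluster h l X \<longleftrightarrow> card X \<le> h \<and> (\<forall>u\<in>X. \<forall>w\<in>X. hamming_dist u w \<le> l)"

lemma cluster_subset:
  fixes X :: "('a::finite ^ 'n::finite) set"
  assumes "cluster h l X" "Y \<subseteq> X"
  shows "cluster h l Y"
  using assms card_mono[of X Y] by (auto simp: cluster_def)

text \<open>Passing from indices to a set of clusters merges repetitions, which can only lower their
  number; conversely a finite family can be enumerated from 1.\<close>

lemma thl_sets_iff_family:
  fixes A B :: "('a::finite ^ 'n::finite) set"
  shows "thl_sets t h l A B \<longleftrightarrow>
    (\<exists>F. card F \<le> t \<and> sym_diff A B = \<Union>F \<and> (\<forall>X\<in>F. cluster h l X))"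
proof
  assume "thl_sets t h l A B"
  then obtain j and X :: "nat \<Rightarrow> ('a ^ 'n) set" where
    "j \<le> t" "sym_diff A B = (\<Union>i\<in>{1..j}. X i)" "\<forall>i\<in>{1..j}. cluster h l (X i)"
    unfolding thl_sets_def cluster_def by blast
  then show "\<exists>F. card F \<le> t \<and> sym_diff A B = \<Union>F \<and> (\<forall>X\<in>F. cluster h l X)"
    using card_image_le[of "{1..j}" X] by (intro exI[of _ "X ` {1..j}"]) auto
next
  assume "\<exists>F. card F \<le> t \<and> sym_diff A B = \<Union>F \<and> (\<forall>X\<in>F. cluster h l X)"
  then obtain F where F: "card F \<le> t" "sym_diff A B = \<Union>F" "\<forall>X\<in>F. cluster h l X"
    by blast
  obtain X where "bij_betw X {1..card F} F"
    using ex_bij_betw_nat_finite_1[of F] by auto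
  then have "X ` {1..card F} = F"
    by (simp add: bij_betw_def)
  moreover from this have "\<forall>i\<in>{1..card F}. cluster h l (X i)"
    using F(3) by blast
  ultimately show "thl_sets t h l A B"
    using F(1,2) unfolding thl_sets_def cluster_def
    by (intro exI[of _ "card F"] exI[of _ X]) simp
qed

lemma thl_sets_sym: "thl_sets t h l A B \<Longrightarrow> thl_sets t h l B A"
  by (simp add: thl_sets_def Un_commute)

lemma thl_sets_mono: "thl_sets s h l A B \<Longrightarrow> s \<le> t \<Longrightarrow> thl_sets t h l A B"
  unfolding thl_sets_def by (meson order_trans)

lemma thl_sets_refl: "thl_sets t h l A A"
  unfolding thl_sets_def by (intro exI[of _ 0]) auto

lemma thl_sets_trans:
  fixes A B :: "('a::finite ^ 'n::finite) set"
  assumes "thl_sets s h l A B" "thl_sets t h l B D"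
  shows "thl_sets (s + t) h l A D"
proof -
  obtain F where F: "card F \<le> s" "sym_diff A B = \<Union>F" "\<forall>X\<in>F. cluster h l X"
    using assms(1) unfolding thl_sets_iff_family by blast
  obtain H where H: "card H \<le> t" "sym_diff B D = \<Union>H" "\<forall>X\<in>H. cluster h l X"
    using assms(2) unfolding thl_sets_iff_family by blast
  \<comment> \<open>Points lying in both differences cancel in \<open>sym_diff A D\<close>. Cutting
    the clusters down to that set removes them, and subsets of clusters are clusters.\<close>
  let ?I = "(\<lambda>X. X \<inter> sym_diff A D) ` (F \<union> H)"
  have "card ?I \<le> s + t"
    using card_image_le[of "F \<union> H" "\<lambda>X. X \<inter> sym_diff A D"] card_Un_le[of F H] F(1) H(1) by simp
  moreover have "sym_diff A D \<subseteq> \<Union>F \<union> \<Union>H"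
    unfolding F(2)[symmetric] H(2)[symmetric] by blast
  then have "sym_diff A D = \<Union>?I"
    by blast
  moreover have "\<forall>X\<in>?I. cluster h l X"
    using F(3) H(3) by (auto intro: cluster_subset)
  ultimately show ?thesis
    unfolding thl_sets_iff_family by blast
qed

lemma thl_graph_sym: "thl_graph t h l A B \<Longrightarrow> thl_graph t h l B A"
  by (auto simp: thl_graph_def intro: thl_sets_sym)

lemma thl_sets_if_square:
  fixes A B :: "('a::finite ^ 'n::finite) set"
  assumes "A = B \<or> graph_square (thl_graph t h l) A B"
  shows "thl_sets (2 * t) h l A B"
  using assms thl_sets_trans[of t h l A _ t B]
  by (auto simp: graph_square_iff thl_graph_def mult_2 intro: thl_sets_refl thl_sets_mono)

section \<open>Upper bound: size of a closed neighbourhood\<close>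

text \<open>Clusters are added one at a time, each stripped of the points already covered. If
  anything remains, any remaining point serves as a new centre.\<close>

lemma family_star_system:
  fixes F :: "('a::finite ^ 'n::finite) set set"
  assumes "\<forall>X\<in>F. cluster h l X"
  shows "\<exists>T f. card T \<le> card F \<and> \<Union>F = star_union (T, f) \<and>
    (\<forall>x\<in>T. f x \<subseteq> punctured_ball l x \<and> card (f x) \<le> h - 1)"
  using finite[of F] assms
proof (induction F rule: finite_induct)
  case empty
  then show ?case by (intro exI[of _ "{}"]) (simp add: star_union_def)
next
  case (insert X F)
  then obtain T f where Tf: "card T \<le> card F" "\<Union>F = star_union (T, f)"
    "\<forall>x\<in>T. f x \<subseteq> punctured_ball l x \<and> card (f x) \<le> h - 1"
    by auto
  have X: "cluster h l (X - \<Union>F)"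
    using insert.prems by (auto intro: cluster_subset)
  show ?case
  proof (cases "X - \<Union>F = {}")
    case True
    then have "\<Union>(insert X F) = \<Union>F" by auto
    with Tf insert.hyps show ?thesis
      by (intro exI[of _ T] exI[of _ f]) auto
  next
    case False
    then obtain x where x: "x \<in> X - \<Union>F" by blast
    then have "x \<notin> T"
      using Tf(2) by (auto simp: star_union_def)
    let ?f = "f(x := X - \<Union>F - {x})"
    have "\<Union>(insert X F) = insert x (X - \<Union>F - {x}) \<union> star_union (T, f)"
      using x unfolding Tf(2)[symmetric] by blast
    also have "\<dots> = star_union (insert x T, ?f)"
    proof -
      have "(\<Union>y\<in>T. insert y (?f y)) = (\<Union>y\<in>T. insert y (f y))"
        using \<open>x \<notin> T\<close> by (intro SUP_cong) auto
      then show ?thesis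
        by (simp add: star_union_def)
    qed
    finally have "\<Union>(insert X F) = star_union (insert x T, ?f)" .
    moreover have "card (insert x T) \<le> card (insert X F)"
      using Tf(1) insert.hyps \<open>x \<notin> T\<close> by simp
    \<comment> \<open>The diameter bound \<open>l\<close> puts the remaining points near
      \<open>x\<close>, and removing \<open>x\<close> itself lowers the size bound from
      \<open>h\<close> to \<open>h - 1\<close>.\<close>
    moreover have "X - \<Union>F - {x} \<subseteq> punctured_ball l x" "card (X - \<Union>F - {x}) \<le> h - 1"
      using X x by (auto simp: cluster_def punctured_ball_def card_Diff_singleton)
    then have "\<forall>y\<in>insert x T. ?f y \<subseteq> punctured_ball l y \<and> card (?f y) \<le> h - 1"
      using Tf(3) by simp
    ultimately show ?thesis
      by blast
  qed
qed

lemma card_thl_sets_le: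
  fixes A :: "('a::finite ^ 'n::finite) set"
  shows "card {B. thl_sets s h l A B} \<le> card (star_systems (UNIV :: ('a ^ 'n) set) {0..s} (h - 1) l)"
proof -
  have "{B. thl_sets s h l A B} \<subseteq>
      (\<lambda>p. sym_diff A (star_union p)) ` star_systems UNIV {0..s} (h - 1) l"
  proof
    fix B assume "B \<in> {B. thl_sets s h l A B}"
    then obtain F where F: "card F \<le> s" "sym_diff A B = \<Union>F" "\<forall>X\<in>F. cluster h l X"
      unfolding thl_sets_iff_family by blast
    obtain T f where Tf: "card T \<le> card F" "\<Union>F = star_union (T, f)"
      "\<forall>x\<in>T. f x \<subseteq> punctured_ball l x \<and> card (f x) \<le> h - 1"
      using family_star_system[OF F(3)] by blast
    \<comment> \<open>\<open>PiE\<close> admits only functions that are \<open>undefined\<close>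
      outside \<open>T\<close>; \<open>star_union\<close> looks at \<open>f\<close> on
      \<open>T\<close> alone.\<close>
    let ?p = "(T, restrict f T)"
    have "B = sym_diff A (sym_diff A B)"
      by blast
    also have "sym_diff A B = star_union ?p"
      using F(2) Tf(2) by (auto simp: star_union_def)
    finally have "B = sym_diff A (star_union ?p)" .
    moreover have "?p \<in> star_systems UNIV {0..s} (h - 1) l"
      using F(1) Tf(1,3) by (auto simp: star_systems_def)
    ultimately show "B \<in> (\<lambda>p. sym_diff A (star_union p)) ` star_systems UNIV {0..s} (h - 1) l"
      by blast
  qed
  moreover have "finite (star_systems (UNIV :: ('a ^ 'n) set) {0..s} (h - 1) l)"
    unfolding star_systems_def by (auto intro!: finite_SigmaI finite_PiE)
  ultimately show ?thesis
    by (rule surj_card_le[rotated])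
qed

section \<open>Lower bound: a clique around the empty set\<close>

text \<open>Two points within \<open>r\<close> of a common centre are at distance at most
  \<open>2 * r\<close>. Having at least one centre makes the union differ from
  \<open>{}\<close>.\<close>

lemma star_union_neighbor:
  fixes V :: "('a::finite ^ 'n::finite) set"
  assumes p: "p \<in> star_systems V {1..t} (h - 1) r" and "h \<ge> 1" "2 * r \<le> l"
  shows "thl_graph t h l {} (star_union p)"
proof -
  obtain T f where Tf: "p = (T, f)" "card T \<in> {1..t}"
    "\<And>x. x \<in> T \<Longrightarrow> f x \<subseteq> punctured_ball r x \<and> card (f x) \<le> h - 1"
    using p by (fastforce simp: star_systems_def PiE_iff)
  have "cluster h l (insert x (f x))" if "x \<in> T" for x
  proof -
    have "card (insert x (f x)) \<le> h"
      using card_insert_le_m1[of h "f x" x] Tf(3)[OF that] \<open>h \<ge> 1\<close> by simp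
    moreover have "hamming_dist u w \<le> l" if "u \<in> insert x (f x)" "w \<in> insert x (f x)" for u w
    proof -
      have "hamming_dist x u \<le> r" "hamming_dist x w \<le> r"
        using that Tf(3)[OF \<open>x \<in> T\<close>] by (auto simp: punctured_ball_def)
      then show ?thesis
        using hamming_dist_triangle[of u w x] hamming_dist_commute[of u x] \<open>2 * r \<le> l\<close> by simp
    qed
    ultimately show ?thesis by (simp add: cluster_def)
  qed
  moreover have "card ((\<lambda>x. insert x (f x)) ` T) \<le> t"
    using card_image_le[of T "\<lambda>x. insert x (f x)"] Tf(2) by simp
  ultimately have "thl_sets t h l {} (star_union p)"
    unfolding thl_sets_iff_family
    by (intro exI[of _ "(\<lambda>x. insert x (f x)) ` T"]) (auto simp: star_union_def Tf(1))
  moreover have "star_union p \<noteq> {}"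
    using Tf(2) by (auto simp: star_union_def Tf(1))
  ultimately show ?thesis by (auto simp: thl_graph_def)
qed

text \<open>A system can be decoded from its union: the codewords in it are the centres, and
  intersecting it with the punctured ball of a centre returns the points attached there, since balls
  of radius \<open>r\<close> around distinct codewords are disjoint.\<close>

lemma inj_on_star_union:
  fixes C :: "('a::finite ^ 'n::finite) set"
  assumes far: "\<And>x y. x \<in> C \<Longrightarrow> y \<in> C \<Longrightarrow> x \<noteq> y \<Longrightarrow> 2 * r < hamming_dist x y"
  shows "inj_on star_union (star_systems C J m r)"
proof (rule inj_on_inverseI)
  fix p assume "p \<in> star_systems C J m r"
  then obtain T f where Tf: "p = (T, f)" "T \<subseteq> C" "f \<in> extensional T"
    "\<And>x. x \<in> T \<Longrightarrow> f x \<subseteq> punctured_ball r x"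
    by (fastforce simp: star_systems_def PiE_iff)
  have apart: "y = x" if "x \<in> C" "y \<in> C" "hamming_dist x z \<le> r" "hamming_dist y z \<le> r" for x y z
    using far[OF that(1,2)] that(3,4) hamming_dist_triangle[of x y z] hamming_dist_commute[of y z]
    by fastforce
  have T: "star_union p \<inter> C = T"
  proof (intro equalityI subsetI)
    fix z assume "z \<in> star_union p \<inter> C"
    then obtain x where "x \<in> T" "z = x \<or> z \<in> punctured_ball r x" "z \<in> C"
      using Tf(1,4) by (auto simp: star_union_def)
    then show "z \<in> T"
      using apart[of x z z] Tf(2) by (auto simp: punctured_ball_def)
  qed (use Tf(1,2) in \<open>auto simp: star_union_def\<close>)
  have "star_union p \<inter> punctured_ball r x = f x" if "x \<in> T" for x
  proof (intro equalityI subsetI)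
    fix z assume z: "z \<in> star_union p \<inter> punctured_ball r x"
    then obtain y where y: "y \<in> T" "z \<in> insert y (f y)"
      using Tf(1) by (auto simp: star_union_def)
    then have "hamming_dist y z \<le> r"
      using Tf(4) by (auto simp: punctured_ball_def)
    then have "y = x"
      using z y that Tf(2) apart[of x y z] by (auto simp: punctured_ball_def)
    \<comment> \<open>The punctured ball excludes \<open>z = x\<close>, so \<open>z\<close> can only
      come from \<open>f x\<close>.\<close>
    then show "z \<in> f x"
      using y(2) z by (auto simp: punctured_ball_def)
  qed (use that Tf(1,4) in \<open>auto simp: star_union_def\<close>)
  then have "restrict (\<lambda>x. star_union p \<inter> punctured_ball r x) T = f"
    using Tf(3) by (auto simp: fun_eq_iff extensional_def)
  then show "(star_union p \<inter> C,
      restrict (\<lambda>x. star_union p \<inter> punctured_ball r x) (star_union p \<inter> C)) = p"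
    using T Tf(1) by simp
qed

theorem theorem2:
  fixes C :: "('a::{finite,field} ^ 'n::finite) set"
    and q n t h l r1 r2 :: nat
  assumes q: "CARD('a) = q" "\<exists>m. q = 2 ^ m"
    and n: "CARD('n) = n"
    and pos: "n \<ge> 1" "t \<ge> 1" "h \<ge> 1" "l \<ge> 1"
    and C: "has_min_distance C (l + 1)"
    and r1: "r1 = (\<Sum>i = 1..l div 2. (n choose i) * (q - 1) ^ i)"
    and r2: "r2 = (\<Sum>i = 1..l. (n choose i) * (q - 1) ^ i)"
  defines "G \<equiv> (thl_graph t h l :: ('a ^ 'n) set \<Rightarrow> ('a ^ 'n) set \<Rightarrow> bool)"
  shows "(\<Sum>j = 1..t. (card C choose j) * (\<Sum>k = 0..h - 1. r1 choose k) ^ j)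
           \<le> chromatic_number (graph_square G)
       \<and> chromatic_number (graph_square G)
           \<le> (\<Sum>j = 0..2 * t. (q ^ n choose j) * (\<Sum>k = 0..h - 1. r2 choose k) ^ j)"
proof -
  have sym: "graph_square G B A" if "graph_square G A B" for A B
    using that thl_graph_sym unfolding G_def by (rule graph_square_sym[rotated])
  have irrefl: "\<not> graph_square G A A" for A
    by (simp add: graph_square_iff)
  let ?L = "star_systems C {1..t} (h - 1) (l div 2)"
  \<comment> \<open>Distinct codewords are at distance at least \<open>l + 1\<close>, which exceeds
    \<open>2 * (l div 2)\<close> for either parity of \<open>l\<close>.\<close>
  have "inj_on star_union ?L"
    using C by (intro inj_on_star_union) (fastforce simp: has_min_distance_def)
  then have "card ?L = card (star_union ` ?L)"
    by (simp add: card_image)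
  also have "\<dots> \<le> chromatic_number (graph_square G)"
  proof (rule clique_le_chromatic_number[OF sym irrefl])
    fix A B assume AB: "A \<in> star_union ` ?L" "B \<in> star_union ` ?L" "A \<noteq> B"
    have "G {} D" if "D \<in> star_union ` ?L" for D
      using that pos(3) unfolding G_def by (auto intro: star_union_neighbor)
    \<comment> \<open>The empty set is the middle vertex of a walk of length 2 from \<open>A\<close>
      to \<open>B\<close>.\<close>
    then have "G A {}" "G {} B"
      using AB(1,2) unfolding G_def by (blast intro: thl_graph_sym)+
    with \<open>A \<noteq> B\<close> show "graph_square G A B"
      by (auto simp: graph_square_iff)
  qed
  finally have lower: "card ?L \<le> chromatic_number (graph_square G)" .
  let ?U = "star_systems (UNIV :: ('a ^ 'n) set) {0..2 * t} (h - 1) l"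
  have "card {B. B = A \<or> graph_square G A B} \<le> card ?U" for A
  proof -
    have "card {B. B = A \<or> graph_square G A B} \<le> card {B. thl_sets (2 * t) h l A B}"
      unfolding G_def by (intro card_mono) (auto intro: thl_sets_if_square)
    also have "\<dots> \<le> card ?U"
      by (rule card_thl_sets_le)
    finally show ?thesis .
  qed
  then have "chromatic_number (graph_square G) \<le> card ?U"
    using greedy_coloring[of "graph_square G"] sym irrefl chromatic_number_le by blast
  with lower show ?thesis
    by (simp add: card_star_systems r1 r2 n q(1))
qed

end
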